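(* Let $p\ge q>1$ be integers and let $H$ be a finite family of $d$-intervals satisfying the $(p,q)$ property. Then $$\tau(H)\le \max\Big\{\frac{2^{\frac{1}{q-1}}(ep)^\frac{q}{q-1}}{q}\, d^{\frac{q}{q-1}} + d,~ 2p^2d\Big\}.$$
   Context: A $d$-interval is a union of at most $d$ disjoint closed intervals on the real line. A family of sets satisfies the $(p,q)$ property if among any $p$ members of it some $q$ have a common point. For a family $H$ of $d$-intervals, $\tau(H)$ is the minimum number of points of $\mathbb{R}$ needed so that every member of $H$ contains one of them. Here $e$ is Euler's number. *)

theory Defs
  imports "HOL-Analysis.Analysis"
begin

text \<open>
  The components of a \<open>d\<close>-interval are nonempty compact intervals, possibly
  single points, and there is at least one of them: no point pierces the empty set, so a
  family containing it would have no finite piercing number.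
\<close>

definition d_interval :: "nat \<Rightarrow> real set \<Rightarrow> bool" where
  "d_interval d S \<longleftrightarrow>
     S \<noteq> {} \<and>
     (\<exists>C. finite C \<and> card C \<le> d \<and> disjoint C \<and>
          (\<forall>I\<in>C. \<exists>a b. a \<le> b \<and> I = {a..b}) \<and> S = \<Union>C)"

text \<open>
  The \<open>p\<close> members are distinct, so the property is vacuous for a family with fewer than
  \<open>p\<close> members. The definition is meant for \<open>p, q \<ge> 1\<close>.
\<close>

definition pq_property :: "nat \<Rightarrow> nat \<Rightarrow> 'a set set \<Rightarrow> bool" where
  "pq_property p q H \<longleftrightarrow>
     (\<forall>F\<subseteq>H. card F = p \<longrightarrow> (\<exists>G\<subseteq>F. card G = q \<and> \<Inter>G \<noteq> {}))"

text \<open>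
  The minimum below exists whenever \<open>H\<close> is a finite family of nonempty sets; otherwise the
  value may be unspecified.
\<close>

definition piercing_number :: "'a set set \<Rightarrow> nat" where
  "piercing_number H =
     (LEAST n. \<exists>P. finite P \<and> card P = n \<and> (\<forall>S\<in>H. S \<inter> P \<noteq> {}))"

end

theory Submission
  imports Defs
begin

text \<open>
  Put probability weights on \<open>H\<close> and sample \<open>p\<close> members independently. If no point lay in
  members of total weight \<open>1 / B\<close>, a repetition would have probability below \<open>1/2\<close>, and the
  probability that some \<open>q\<close> of the samples have a common point, which may be taken to be the left
  end of a component of one of them, would be at most \<open>1/2\<close>; this contradicts the \<open>(p, q)\<close>
  property. The existence of such a heavy point for all weights means, by duality, that the
  fractional piercing number is at most \<open>B\<close>. Here duality is replaced by multiplicative weights: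
  choosing heavy points repeatedly and discounting the members hit yields a finite sample of
  points hitting every member with frequency arbitrarily close to \<open>1 / B\<close>. Some component of
  each member then contains about a fraction \<open>1 / (d B)\<close> of the sample, so equally spaced
  elements of the sorted sample, at most \<open>d B\<close> of them, pierce \<open>H\<close>.
\<close>

section \<open>Random sampling: existence of a heavy point\<close>

lemma sum_UN_bound:
  fixes g :: "'b \<Rightarrow> real"
  assumes "finite I" and "\<And>i. i \<in> I \<Longrightarrow> finite (A i)" and "\<And>x. 0 \<le> g x"
    and "\<And>i. i \<in> I \<Longrightarrow> sum g (A i) \<le> c i"
  shows "sum g (\<Union>i\<in>I. A i) \<le> sum c I"
  using assms(1,2,4)
proof (induction I rule: finite_induct)
  case (insert i I)
  have "sum g (A i \<union> (\<Union>i\<in>I. A i)) \<le> sum g (A i) + sum g (\<Union>i\<in>I. A i)"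
    using insert.prems insert.hyps assms(3) by (simp add: sum_Un sum_nonneg)
  with insert show ?case by (simp, smt (verit))
qed simp

text \<open>The geometry enters only through the candidate points \<open>L S\<close>. The union
  bound ranges over \<open>q\<close> positions, the one among them whose member supplies the common
  point, and its at most \<open>d\<close> candidates. \<open>B1\<close> controls repeated samples,
  \<open>B2\<close> controls common points.\<close>

lemma heavy_point:
  fixes H :: "'a set set" and w :: "'a set \<Rightarrow> real" and L :: "'a set \<Rightarrow> 'a set"
  assumes fin: "finite H" and pq: "pq_property p q H" and q: "q > 0" and p: "p > 0"
    and ne: "{} \<notin> H"
    and w0: "\<And>S. 0 \<le> w S" and w1: "sum w H = 1"
    and Lfin: "\<And>S. S \<in> H \<Longrightarrow> finite (L S)" and Lcard: "\<And>S. S \<in> H \<Longrightarrow> card (L S) \<le> d"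
    and L: "\<And>G. G \<subseteq> H \<Longrightarrow> G \<noteq> {} \<Longrightarrow> \<Inter>G \<noteq> {} \<Longrightarrow> \<exists>S\<in>G. L S \<inter> \<Inter>G \<noteq> {}"
    and B1: "2 * real p ^ 2 \<le> B"
    and B2: "2 * real q * real (p choose q) * real d \<le> B ^ (q - 1)"
  shows "\<exists>x. 1 / B \<le> sum w {S\<in>H. x \<in> S}"
proof (rule ccontr)
  assume "\<not> ?thesis"
  then have light: "sum w {S\<in>H. x \<in> S} < 1 / B" for x by (meson not_le)
  have Bpos: "B > 0" using B1 p by (smt (verit) of_nat_0_less_iff zero_less_power)
  \<comment> \<open>This bounds the chance that a given draw repeats the member
    \<open>S\<close>.\<close>
  have wlt: "w S < 1 / B" if "S \<in> H" for S
  proof -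
    have "S \<noteq> {}" using ne that by metis
    then obtain x where "x \<in> S" by blast
    then have "w S \<le> sum w {S\<in>H. x \<in> S}"
      using that fin w0 by (intro member_le_sum) auto
    with light[of x] show ?thesis by linarith
  qed
  \<comment> \<open>\<open>W f\<close> is the probability that \<open>p\<close> independent draws
    from \<open>w\<close> give \<open>f\<close>; a box in \<open>PiE\<close> then has the product of
    its marginal weights.\<close>
  define W where "W f = (\<Prod>i<p. w (f i))" for f
  have W0: "0 \<le> W f" for f unfolding W_def by (simp add: prod_nonneg w0)
  have W_PiE: "sum W (PiE {..<p} A) = (\<Prod>i<p. sum w (A i))" if "\<And>i. i < p \<Longrightarrow> finite (A i)" for A
    unfolding W_def using that by (subst prod_sum_PiE) auto
  \<comment> \<open>\<open>X\<close>: samples with a repetition; \<open>Y\<close>: samples in which the positions \<open>J\<close>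
      share the point \<open>l \<in> L S\<close>, where \<open>S\<close> is the member at position \<open>j\<close>.\<close>
  define X where "X = (\<Union>i\<in>{..<p}. \<Union>j\<in>{..<p}-{i}. \<Union>S\<in>H.
      PiE {..<p} (\<lambda>k. if k = i \<or> k = j then {S} else H))"
  define Y where "Y = (\<Union>J\<in>{J. J \<subseteq> {..<p} \<and> card J = q}. \<Union>j\<in>J. \<Union>S\<in>H. \<Union>l\<in>L S.
      PiE {..<p} (\<lambda>k. if k = j then {S} else if k \<in> J then {T\<in>H. l \<in> T} else H))"
  have finX: "finite X"
    unfolding X_def by (intro finite_UN_I finite_PiE) (auto simp: fin)
  have finJ: "finite {J. J \<subseteq> {..<p} \<and> card J = q}"
    by (rule finite_subset[of _ "Pow {..<p}"]) auto
  have finsub: "finite J" if "J \<in> {J. J \<subseteq> {..<p} \<and> card J = q}" for J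
    using that finite_subset by blast
  have finPiY: "finite (PiE {..<p} (\<lambda>k. if k = j then {S} else if k \<in> J then {T\<in>H. l \<in> T} else H))"
    for j l S J
    using fin by (intro finite_PiE) auto
  have finY: "finite Y"
    unfolding Y_def
    by (intro finite_UN_I finPiY | rule finJ fin Lfin | erule finsub | assumption)+
  have cover: "PiE {..<p} (\<lambda>_. H) \<subseteq> X \<union> Y"
  proof
    fix f assume f: "f \<in> PiE {..<p} (\<lambda>_. H)"
    show "f \<in> X \<union> Y"
    proof (cases "inj_on f {..<p}")
      case False
      then obtain i j where ij: "i < p" "j < p" "i \<noteq> j" "f i = f j" unfolding inj_on_def by auto
      have "f i \<in> H" using f ij by auto
      moreover have "f \<in> PiE {..<p} (\<lambda>k. if k = i \<or> k = j then {f i} else H)"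
        using f ij by (auto simp: PiE_def Pi_def)
      ultimately have "f \<in> X" unfolding X_def
        using ij by (intro UN_I[of i] UN_I[of j] UN_I[of "f i"]) auto
      then show ?thesis by simp
    next
      case True
      \<comment> \<open>Without repetitions the draws form \<open>p\<close> distinct members, so the
        property applies, and \<open>q\<close> members come from exactly \<open>q\<close>
        positions.\<close>
      have "f ` {..<p} \<subseteq> H" "card (f ` {..<p}) = p"
        using f True by (auto simp: card_image)
      then obtain G where G: "G \<subseteq> f ` {..<p}" "card G = q" "\<Inter>G \<noteq> {}"
        using pq unfolding pq_property_def by metis
      define J where "J = {i\<in>{..<p}. f i \<in> G}"
      have GJ: "G = f ` J" using G(1) unfolding J_def by auto
      have Jsub: "J \<subseteq> {..<p}" unfolding J_def by auto
      have cJ: "card J = q"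
        using G(2) unfolding GJ using inj_on_subset[OF True Jsub] by (simp add: card_image)
      have "G \<subseteq> H" "G \<noteq> {}" using G q \<open>f ` {..<p} \<subseteq> H\<close> by auto
      from L[OF this G(3)] obtain S l where S: "S \<in> G" "l \<in> L S" "l \<in> \<Inter>G" by blast
      then obtain j where j: "j \<in> J" "S = f j" using GJ by auto
      have SH: "S \<in> H" using S \<open>G \<subseteq> H\<close> by auto
      have "f \<in> PiE {..<p} (\<lambda>k. if k = j then {S} else if k \<in> J then {T\<in>H. l \<in> T} else H)"
        using f j S(3) GJ by (auto simp: PiE_def Pi_def)
      then have "f \<in> Y" unfolding Y_def
        using Jsub cJ j(1) SH S(2) by (intro UN_I[of J] UN_I[of j] UN_I[of S] UN_I[of l]) auto
      then show ?thesis by simp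
    qed
  qed
  have X_bound: "sum W X \<le> (\<Sum>i<p. \<Sum>j\<in>{..<p}-{i}. \<Sum>S\<in>H. w S * (1 / B))"
    unfolding X_def
  proof (intro sum_UN_bound W0)
    fix i j S assume ij: "i \<in> {..<p}" "j \<in> {..<p} - {i}" and S: "S \<in> H"
    have "sum W (PiE {..<p} (\<lambda>k. if k = i \<or> k = j then {S} else H))
        = (\<Prod>k<p. sum w (if k = i \<or> k = j then {S} else H))"
      using fin by (intro W_PiE) auto
    also have "\<dots> = (\<Prod>k<p. if k \<in> {i, j} then w S else 1)"
      by (intro prod.cong) (auto simp: w1)
    also have "\<dots> = (\<Prod>k\<in>{..<p} \<inter> {i, j}. w S)"
      by (rule prod.inter_restrict[symmetric]) simp
    also have "{..<p} \<inter> {i, j} = {i, j}" using ij by auto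
    also have "(\<Prod>k\<in>{i, j}. w S) = w S * w S" using ij by simp
    also have "\<dots> \<le> w S * (1 / B)" using wlt[OF S] w0[of S] by (intro mult_left_mono) auto
    finally show "sum W (PiE {..<p} (\<lambda>k. if k = i \<or> k = j then {S} else H)) \<le> w S * (1 / B)" .
  qed (auto simp: fin intro!: finite_PiE)
  also have "\<dots> = real p * real (p - 1) / B"
    using p by (simp add: w1 of_nat_diff Suc_le_eq flip: sum_divide_distrib)
  \<comment> \<open>Strictness here makes the final contradiction work, since \<open>Y\<close> is
    only bounded by 1/2 weakly.\<close>
  also have "\<dots> < real p * real p / B"
    using p Bpos by (intro divide_strict_right_mono mult_strict_left_mono) auto
  also have "\<dots> \<le> 1 / 2"
    using B1 Bpos by (simp add: field_simps power2_eq_square)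
  finally have X_half: "sum W X < 1 / 2" .
  have "sum W Y \<le> (\<Sum>J | J \<subseteq> {..<p} \<and> card J = q. \<Sum>j\<in>J. \<Sum>S\<in>H. \<Sum>l\<in>L S. w S * (1 / B) ^ (q - 1))"
    unfolding Y_def
  proof (intro sum_UN_bound W0)
    fix J j S l assume J: "J \<in> {J. J \<subseteq> {..<p} \<and> card J = q}" and j: "j \<in> J"
      and S: "S \<in> H" and l: "l \<in> L S"
    let ?w = "\<lambda>k. if k = j then {S} else if k \<in> J then {T\<in>H. l \<in> T} else H"
    have "sum W (PiE {..<p} ?w) = (\<Prod>k<p. sum w (?w k))"
      using fin by (intro W_PiE) auto
    also have "\<dots> = (\<Prod>k<p. if k \<in> J then sum w (?w k) else 1)"
      using j by (intro prod.cong) (auto simp: w1)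
    also have "\<dots> = (\<Prod>k\<in>{..<p} \<inter> J. sum w (?w k))"
      by (rule prod.inter_restrict[symmetric]) simp
    also have "{..<p} \<inter> J = J" using J by auto
    \<comment> \<open>Position \<open>j\<close> contributes \<open>w S\<close>, which sums to 1 over
      \<open>H\<close>; the other positions of \<open>J\<close> give the exponent
      \<open>q - 1\<close>.\<close>
    also have "(\<Prod>k\<in>J. sum w (?w k)) = w S * (\<Prod>k\<in>J-{j}. sum w (?w k))"
      using j finsub[OF J] by (subst prod.remove[of _ j]) auto
    also have "(\<Prod>k\<in>J-{j}. sum w (?w k)) = sum w {T\<in>H. l \<in> T} ^ (q - 1)"
    proof -
      have "(\<Prod>k\<in>J-{j}. sum w (?w k)) = (\<Prod>k\<in>J-{j}. sum w {T\<in>H. l \<in> T})"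
        by (intro prod.cong) auto
      also have "\<dots> = sum w {T\<in>H. l \<in> T} ^ (q - 1)"
        using j J finsub[OF J] by (simp add: card_Diff_singleton)
      finally show ?thesis .
    qed
    also have "w S * \<dots> \<le> w S * (1 / B) ^ (q - 1)"
      using light[of l] by (intro mult_left_mono power_mono w0 sum_nonneg) auto
    finally show "sum W (PiE {..<p} ?w) \<le> w S * (1 / B) ^ (q - 1)" .
  qed (intro finite_UN_I finPiY | rule finJ fin Lfin | erule finsub | assumption)+
  also have "\<dots> \<le> (\<Sum>J | J \<subseteq> {..<p} \<and> card J = q. \<Sum>j\<in>J. \<Sum>S\<in>H. w S * (real d * (1 / B) ^ (q - 1)))"
  proof (intro sum_mono)
    fix S assume S: "S \<in> H"
    have "(\<Sum>l\<in>L S. w S * (1 / B) ^ (q - 1)) = real (card (L S)) * (w S * (1 / B) ^ (q - 1))" by simp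
    also have "\<dots> \<le> real d * (w S * (1 / B) ^ (q - 1))"
      using Lcard[OF S] Bpos w0[of S] by (intro mult_right_mono) auto
    finally show "(\<Sum>l\<in>L S. w S * (1 / B) ^ (q - 1)) \<le> w S * (real d * (1 / B) ^ (q - 1))"
      by (simp add: mult_ac)
  qed
  also have "\<dots> = (\<Sum>J | J \<subseteq> {..<p} \<and> card J = q. \<Sum>j\<in>J. real d * (1 / B) ^ (q - 1))"
    by (simp only: w1 mult_1 flip: sum_distrib_right)
  also have "\<dots> = (\<Sum>J | J \<subseteq> {..<p} \<and> card J = q. real q * (real d * (1 / B) ^ (q - 1)))"
    by (intro sum.cong) auto
  also have "\<dots> = real (p choose q) * (real q * (real d * (1 / B) ^ (q - 1)))"
    by (simp add: n_subsets)
  also have "\<dots> \<le> 1 / 2"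
    using B2 Bpos by (simp add: field_simps)
  finally have Y_half: "sum W Y \<le> 1 / 2" .
  have "1 = sum W (PiE {..<p} (\<lambda>_. H))"
    using W_PiE[of "\<lambda>_. H"] fin w1 by simp
  also have "\<dots> \<le> sum W (X \<union> Y)"
    using finX finY cover W0 by (intro sum_mono2) auto
  also have "\<dots> \<le> sum W X + sum W Y"
    using finX finY W0 by (simp add: sum_Un sum_nonneg)
  finally show False using X_half Y_half by linarith
qed

section \<open>Multiplicative weights in place of linear programming duality\<close>

text \<open>The total weight is a potential: a member hit \<open>n\<close> times weighs
  \<open>exp (- \<eta> * n)\<close>, and each heavy point shrinks the total by a factor
  \<open>exp (- a * c)\<close>. No member outweighs the total, so after \<open>T\<close> rounds
  \<open>\<eta> * n\<close> is at least \<open>a * c * T - ln (card H)\<close>, which exceeds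
  \<open>\<eta> * r * T\<close> for large \<open>T\<close>.\<close>

lemma fractional_cover_sample:
  fixes H :: "'a set set" and c r :: real
  assumes fin: "finite H" and r: "0 \<le> r" "r < c"
    and heavy: "\<And>w. (\<And>S. 0 < w S) \<Longrightarrow> \<exists>x. c * sum w H \<le> sum w {S\<in>H. x \<in> S}"
  shows "\<exists>xs. xs \<noteq> [] \<and> (\<forall>S\<in>H. r * real (length xs) < real (length (filter (\<lambda>x. x \<in> S) xs)))"
proof (cases "H = {}")
  case True
  then show ?thesis by (intro exI[of _ "[undefined]"]) auto
next
  case False
  \<comment> \<open>\<open>a\<close> is the fraction of its weight that a member loses when hit.
    Since \<open>a\<close> is at least \<open>\<eta> / (1 + \<eta>)\<close>, the needed
    \<open>\<eta> * r < a * c\<close> follows from \<open>r * (1 + \<eta>) < c\<close>, which this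
    choice ensures.\<close>
  define \<eta> where "\<eta> = (c - r) / (r + 1)"
  define a where "a = 1 - exp (- \<eta>)"
  have \<eta>: "\<eta> > 0" unfolding \<eta>_def using r by simp
  have a0: "0 < a" unfolding a_def using \<eta> by simp
  have "exp (- \<eta>) \<le> 1 / (1 + \<eta>)"
    using exp_ge_add_one_self[of \<eta>] \<eta> by (simp add: exp_minus field_simps)
  then have a1: "\<eta> / (1 + \<eta>) \<le> a"
    unfolding a_def using \<eta> by (simp add: field_simps)
  have "r * (1 + \<eta>) < c"
  proof -
    have "r * \<eta> < c - r" unfolding \<eta>_def using r by (simp add: field_simps)
    then show ?thesis by (simp add: algebra_simps)
  qed
  then have "\<eta> / (1 + \<eta>) * (r * (1 + \<eta>)) < \<eta> / (1 + \<eta>) * c"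
    using \<eta> by (intro mult_strict_left_mono) auto
  then have "\<eta> * r < c * (\<eta> / (1 + \<eta>))"
    using \<eta> by (simp add: mult.commute)
  also have "\<dots> \<le> c * a" using a1 r by (intro mult_left_mono) auto
  finally have gap: "0 < c * a - \<eta> * r" by simp
  define W where "W xs S = exp (- \<eta> * real (length (filter (\<lambda>x. x \<in> S) xs)))" for xs and S :: "'a set"
  have ex: "\<exists>xs. length xs = T \<and> sum (W xs) H \<le> real (card H) * exp (- a * c * real T)" for T
  proof (induction T)
    case 0
    show ?case by (intro exI[of _ "[]"]) (simp add: W_def)
  next
    case (Suc T)
    then obtain xs where xs: "length xs = T"
      "sum (W xs) H \<le> real (card H) * exp (- a * c * real T)" by blast
    obtain x where x: "c * sum (W xs) H \<le> sum (W xs) {S\<in>H. x \<in> S}"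
      using heavy[of "W xs"] unfolding W_def by auto
    have "sum (W (x # xs)) H = (\<Sum>S\<in>H. W xs S - a * (if x \<in> S then W xs S else 0))"
      by (intro sum.cong) (auto simp: W_def a_def algebra_simps simp flip: exp_add)
    also have "\<dots> = sum (W xs) H - a * sum (W xs) {S\<in>H. x \<in> S}"
      using fin by (simp add: sum_subtractf sum.inter_filter flip: sum_distrib_left)
    also have "\<dots> \<le> sum (W xs) H - a * (c * sum (W xs) H)"
      using x a0 by simp
    also have "\<dots> = (1 + - a * c) * sum (W xs) H" by (simp add: algebra_simps)
    also have "\<dots> \<le> exp (- a * c) * sum (W xs) H"
      by (intro mult_right_mono exp_ge_add_one_self sum_nonneg) (simp add: W_def)
    also have "\<dots> \<le> exp (- a * c) * (real (card H) * exp (- a * c * real T))"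
      using xs(2) by (intro mult_left_mono) auto
    also have "\<dots> = real (card H) * exp (- a * c * real (Suc T))"
      by (simp add: algebra_simps flip: exp_add)
    finally show ?case using xs(1) by (intro exI[of _ "x # xs"]) simp
  qed
  obtain T where T: "ln (real (card H)) < real T * (c * a - \<eta> * r)"
    using ex_less_of_nat_mult[OF gap] by blast
  have cardH: "card H \<ge> 1" using False fin by (simp add: Suc_leI card_gt_0_iff)
  have "T > 0"
  proof (rule ccontr)
    assume "\<not> T > 0"
    with T have "ln (real (card H)) < 0" by simp
    moreover have "ln (real (card H)) \<ge> 0" using cardH by simp
    ultimately show False by linarith
  qed
  obtain xs where xs: "length xs = T" "sum (W xs) H \<le> real (card H) * exp (- a * c * real T)"
    using ex by blast
  have "r * real (length xs) < real (length (filter (\<lambda>x. x \<in> S) xs))" if S: "S \<in> H" for S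
  proof -
    let ?n = "real (length (filter (\<lambda>x. x \<in> S) xs))"
    have "W xs S \<le> sum (W xs) H"
      using S fin by (intro member_le_sum) (auto simp: W_def)
    with xs(2) have "exp (- \<eta> * ?n) \<le> real (card H) * exp (- a * c * real T)"
      unfolding W_def by linarith
    also have "\<dots> = exp (ln (real (card H)) - a * c * real T)"
      using cardH by (simp add: exp_diff exp_minus field_simps)
    finally have "- \<eta> * ?n \<le> ln (real (card H)) - a * c * real T" by simp
    with T have "\<eta> * (r * real T) < \<eta> * ?n" by (simp add: algebra_simps)
    with \<eta> xs(1) show ?thesis by simp
  qed
  moreover have "xs \<noteq> []" using xs(1) \<open>T > 0\<close> by auto
  ultimately show ?thesis by blast
qed

section \<open>Rounding a sample to a piercing set\<close>

text \<open>By pigeonhole some component of each member contains at least \<open>m\<close> entries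
  of the sample, counted with multiplicity. After sorting, an interval contains every entry between
  two of its entries, so it meets each selection of every \<open>m\<close>-th entry.\<close>

lemma piercing_number_le_sample:
  fixes xs :: "real list"
  assumes dint: "\<And>S. S \<in> H \<Longrightarrow> d_interval d S"
    and many: "\<And>S. S \<in> H \<Longrightarrow> d * length xs < (k + 1) * length (filter (\<lambda>x. x \<in> S) xs)"
  shows "piercing_number H \<le> k"
proof -
  define ys where "ys = sort xs"
  define T where "T = length xs"
  define m where "m = T div (k + 1) + 1"
  \<comment> \<open>Every run of \<open>m\<close> consecutive indices contains one that is \<open>m - 1\<close> modulo \<open>m\<close>.\<close>
  define P where "P = (\<lambda>j. ys ! (m * j + (m - 1))) ` {..<T div m}"
  have len: "length ys = T" and srt: "sorted ys" unfolding ys_def T_def by auto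
  have m0: "m > 0" unfolding m_def by simp
  \<comment> \<open>The \<open>+ 1\<close> in \<open>m\<close> makes this strict, so that there are
    at most \<open>k\<close> complete blocks of length \<open>m\<close>.\<close>
  have "T < (k + 1) * m"
    unfolding m_def using dividend_less_times_div[of "k + 1" T] by simp
  then have "T div m < k + 1" using m0 by (simp add: less_mult_imp_div_less)
  then have cardP: "card P \<le> k"
    unfolding P_def by (intro le_trans[OF card_image_le]) auto
  have hit: "S \<inter> P \<noteq> {}" if S: "S \<in> H" for S
  proof -
    obtain C where C: "finite C" "card C \<le> d" "S = \<Union>C"
      and Cint: "\<forall>I\<in>C. \<exists>a b. a \<le> b \<and> I = {a..b}"
      using dint[OF S] unfolding d_interval_def by (elim conjE exE) (rule that)
    have "length (filter (\<lambda>x. x \<in> S) xs) = length (filter (\<lambda>x. x \<in> S) ys)"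
      unfolding ys_def by (metis mset_filter mset_sort size_mset)
    also have "\<dots> = card {i. i < T \<and> ys ! i \<in> S}" by (simp add: length_filter_conv_card len)
    also have "{i. i < T \<and> ys ! i \<in> S} = (\<Union>I\<in>C. {i. i < T \<and> ys ! i \<in> I})" using C(3) by auto
    also have "card \<dots> \<le> (\<Sum>I\<in>C. card {i. i < T \<and> ys ! i \<in> I})" by (rule card_UN_le[OF C(1)])
    finally have le: "length (filter (\<lambda>x. x \<in> S) xs) \<le> (\<Sum>I\<in>C. card {i. i < T \<and> ys ! i \<in> I})" .
    have "\<exists>I\<in>C. m \<le> card {i. i < T \<and> ys ! i \<in> I}"
    proof (rule ccontr)
      assume "\<not> ?thesis"
      then have "(\<Sum>I\<in>C. card {i. i < T \<and> ys ! i \<in> I}) \<le> (\<Sum>I\<in>C. T div (k + 1))"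
        unfolding m_def by (intro sum_mono) (auto simp: not_le less_Suc_eq_le)
      also have "\<dots> \<le> d * (T div (k + 1))" using C(2) by simp
      finally have "(k + 1) * length (filter (\<lambda>x. x \<in> S) xs) \<le> (k + 1) * (d * (T div (k + 1)))"
        using le by (intro mult_le_mono2) simp
      also have "\<dots> = d * ((k + 1) * (T div (k + 1)))" by (simp only: mult_ac)
      also have "\<dots> \<le> d * T" by (intro mult_le_mono2) (rule times_div_less_eq_dividend)
      finally show False using many[OF S] unfolding T_def by simp
    qed
    then obtain I where I: "I \<in> C" "m \<le> card {i. i < T \<and> ys ! i \<in> I}" by blast
    obtain a b where ab: "I = {a..b}" using Cint I(1) by blast
    define A where "A = {i. i < T \<and> ys ! i \<in> I}"
    have finA: "finite A" unfolding A_def by simp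
    have neA: "A \<noteq> {}" using I(2) m0 unfolding A_def[symmetric] by auto
    have mA: "Min A \<in> A" "Max A \<in> A" using finA neA by auto
    have "A \<subseteq> {Min A..Max A}" using finA by auto
    then have "m \<le> Suc (Max A) - Min A"
      using I(2) card_mono[of "{Min A..Max A}" A] unfolding A_def[symmetric] by simp
    \<comment> \<open>\<open>t\<close> is the last index of the block containing
      \<open>Min A\<close>. It cannot pass \<open>Max A\<close>, as the run has length at least
      \<open>m\<close>; hence the block is complete and \<open>t\<close> was selected.\<close>
    define j where "j = Min A div m"
    define t where "t = m * j + (m - 1)"
    have "Min A = m * j + Min A mod m" unfolding j_def by simp
    moreover have "Min A mod m < m" using m0 by simp
    ultimately have t: "Min A \<le> t" "t \<le> Max A"
      unfolding t_def using \<open>m \<le> Suc (Max A) - Min A\<close> by linarith+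
    have "Max A < T" using mA unfolding A_def by simp
    have "ys ! Min A \<le> ys ! t" "ys ! t \<le> ys ! Max A"
      using t \<open>Max A < T\<close> srt len by (auto intro!: sorted_nth_mono)
    then have "ys ! t \<in> I" using mA unfolding A_def ab by auto
    moreover have "ys ! t \<in> P"
    proof -
      have "(j + 1) * m \<le> T" using t \<open>Max A < T\<close> m0 unfolding t_def by (simp add: algebra_simps)
      then have "j + 1 \<le> T div m" using m0 by (simp add: less_eq_div_iff_mult_less_eq)
      then show ?thesis unfolding P_def t_def by auto
    qed
    ultimately show ?thesis using C(3) I(1) by blast
  qed
  have "piercing_number H \<le> card P"
    unfolding piercing_number_def using hit by (intro Least_le exI[of _ P]) (auto simp: P_def)
  with cardP show ?thesis by simp
qed

section \<open>Candidate points and the binomial estimate\<close>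

text \<open>In each member of \<open>G\<close> take a component through a common point
  \<open>x\<close>. The largest left end of these components is still at most \<open>x\<close>, so
  it lies in all of them.\<close>

lemma d_interval_left_ends:
  assumes fin: "finite H" and dint: "\<And>S. S \<in> H \<Longrightarrow> d_interval d S"
  shows "\<exists>L. (\<forall>S\<in>H. finite (L S) \<and> card (L S) \<le> d) \<and>
    (\<forall>G\<subseteq>H. G \<noteq> {} \<longrightarrow> \<Inter>G \<noteq> {} \<longrightarrow> (\<exists>S\<in>G. L S \<inter> \<Inter>G \<noteq> {}))"
proof -
  have "\<forall>S\<in>H. \<exists>C. finite C \<and> card C \<le> d \<and> (\<forall>I\<in>C. \<exists>a b. a \<le> b \<and> I = {a..b}) \<and> S = \<Union>C"
    using dint unfolding d_interval_def by blast
  then obtain C where C: "\<And>S. S \<in> H \<Longrightarrow> finite (C S)" "\<And>S. S \<in> H \<Longrightarrow> card (C S) \<le> d"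
    "\<And>S I. S \<in> H \<Longrightarrow> I \<in> C S \<Longrightarrow> \<exists>a b. a \<le> b \<and> I = {a..b}" "\<And>S. S \<in> H \<Longrightarrow> S = \<Union>(C S)"
    by metis
  define L where "L S = Inf ` C S" for S
  have "\<exists>S\<in>G. L S \<inter> \<Inter>G \<noteq> {}" if G: "G \<subseteq> H" "G \<noteq> {}" "\<Inter>G \<noteq> {}" for G
  proof -
    obtain x where x: "x \<in> \<Inter>G" using G(3) by blast
    have "\<forall>S\<in>G. \<exists>a b. {a..b} \<in> C S \<and> a \<le> x \<and> x \<le> b"
    proof
      fix S assume S: "S \<in> G"
      then obtain I where "I \<in> C S" "x \<in> I" using x C(4)[of S] G(1) by blast
      moreover from this obtain a b where "I = {a..b}" using C(3)[of S I] S G(1) by blast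
      ultimately show "\<exists>a b. {a..b} \<in> C S \<and> a \<le> x \<and> x \<le> b" by auto
    qed
    then obtain a b where ab: "\<And>S. S \<in> G \<Longrightarrow> {a S..b S} \<in> C S \<and> a S \<le> x \<and> x \<le> b S"
      by metis
    have finG: "finite G" using G(1) fin finite_subset by blast
    have "Max (a ` G) \<in> a ` G" using finG G(2) by simp
    then obtain S where S: "S \<in> G" "a S = Max (a ` G)" by auto
    have "a S \<in> T" if T: "T \<in> G" for T
    proof -
      have "a T \<le> a S" using finG T S(2) by simp
      then have "a S \<in> {a T..b T}" using ab[OF T] ab[OF S(1)] by auto
      then show ?thesis using ab[OF T] C(4)[of T] T G(1) by blast
    qed
    moreover have "a S \<in> L S"
    proof -
      have "Inf {a S..b S} = a S" using ab[OF S(1)] by simp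
      then show ?thesis unfolding L_def using ab[OF S(1)] by (metis imageI)
    qed
    ultimately show ?thesis using S(1) by blast
  qed
  moreover have "finite (L S)" "card (L S) \<le> d" if "S \<in> H" for S
    unfolding L_def using C(1,2)[OF that] card_image_le[of "C S" Inf] by auto
  ultimately show ?thesis by blast
qed

text \<open>\<open>q ^ q / fact q\<close> is one term of the exponential series for
  \<open>exp q\<close>, which bounds \<open>fact q\<close> from below.\<close>

lemma binomial_le_exp:
  assumes "q > 0"
  shows "real (p choose q) \<le> (exp 1 * real p / real q) ^ q"
proof -
  have "real q ^ q /\<^sub>R fact q \<le> exp (real q)"
    using sum_le_suminf[OF summable_exp_generic[of "real q"], of "{q}"] by (simp add: exp_def)
  then have f: "real q ^ q \<le> exp 1 ^ q * fact q"
    by (simp add: field_simps flip: exp_of_nat_mult)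
  have "real ((p choose q) * fact q) \<le> real (p ^ q)"
    using binomial_fact_pow of_nat_mono by blast
  then have b: "real (p choose q) * fact q \<le> real p ^ q" by simp
  have "real (p choose q) * real q ^ q \<le> real (p choose q) * (exp 1 ^ q * fact q)"
    using f by (intro mult_left_mono) auto
  also have "\<dots> = exp 1 ^ q * (real (p choose q) * fact q)" by simp
  also have "\<dots> \<le> exp 1 ^ q * real p ^ q" using b by (intro mult_left_mono) auto
  finally show ?thesis using assms by (simp add: power_divide power_mult_distrib field_simps)
qed

section \<open>Choice of \<open>B\<close> and assembly\<close>

theorem theorem1p2:
  fixes p q d :: nat and H :: "real set set"
  assumes "q > 1" and "p \<ge> q"
    and "finite H"
    and "\<And>S. S \<in> H \<Longrightarrow> d_interval d S"
    and "pq_property p q H"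
  shows "real (piercing_number H) \<le>
    max (2 powr (1 / (real q - 1)) * (exp 1 * real p) powr (real q / (real q - 1)) / real q
           * real d powr (real q / (real q - 1)) + real d)
        (2 * real p ^ 2 * real d)"
proof (cases "d = 0")
  case True
  then have "H = {}"
    using assms(4) by (force simp: d_interval_def)
  then have "piercing_number H \<le> 0"
    using piercing_number_le_sample[of H d "[]" 0] by simp
  then show ?thesis by (simp add: True)
next
  case False
  have p0: "p > 0" using assms by simp
  have qr: "real q - 1 > 0" using assms(1) by simp
  \<comment> \<open>\<open>X\<close> solves
    \<open>X ^ (q - 1) = 2 * q * (exp 1 * p / q) ^ q * d\<close>, the requirement on
    \<open>B\<close> once the binomial coefficient is replaced by its upper bound.\<close>
  define X where "X = (2 * real d) powr (1 / (real q - 1)) * (exp 1 * real p) powr (real q / (real q - 1)) / real q"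
  define B where "B = max X (2 * real p ^ 2)"
  have X0: "X \<ge> 0" unfolding X_def by simp
  have Bpos: "B > 0" unfolding B_def using p0 by (auto simp: less_max_iff_disj)
  have "2 * real q * real (p choose q) * real d \<le> 2 * real q * (exp 1 * real p / real q) ^ q * real d"
    using binomial_le_exp[of q p] assms(1) by (intro mult_right_mono mult_left_mono) auto
  also have "\<dots> = 2 * real d * (exp 1 * real p) ^ q / real q ^ (q - 1)"
  proof -
    have "real q ^ q = real q * real q ^ (q - 1)"
      using assms(1) by (simp flip: power_Suc)
    then show ?thesis using assms(1) by (simp add: power_divide)
  qed
  also have "\<dots> = X ^ (q - 1)"
  proof -
    have e: "real (q - 1) = real q - 1" using assms(1) by simp
    have "((2 * real d) powr (1 / (real q - 1))) ^ (q - 1) = 2 * real d"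
      using False qr by (simp add: powr_power e)
    moreover have "((exp 1 * real p) powr (real q / (real q - 1))) ^ (q - 1) = (exp 1 * real p) ^ q"
      using p0 qr by (simp add: powr_power e powr_realpow)
    ultimately show ?thesis unfolding X_def by (simp only: power_mult_distrib power_divide)
  qed
  also have "\<dots> \<le> B ^ (q - 1)" using X0 unfolding B_def by (intro power_mono) auto
  finally have B2: "2 * real q * real (p choose q) * real d \<le> B ^ (q - 1)" .
  obtain L where L: "\<And>S. S \<in> H \<Longrightarrow> finite (L S)" "\<And>S. S \<in> H \<Longrightarrow> card (L S) \<le> d"
    "\<And>G. G \<subseteq> H \<Longrightarrow> G \<noteq> {} \<Longrightarrow> \<Inter>G \<noteq> {} \<Longrightarrow> \<exists>S\<in>G. L S \<inter> \<Inter>G \<noteq> {}"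
    using d_interval_left_ends[OF assms(3,4)] by blast
  have ne: "{} \<notin> H" using assms(4) unfolding d_interval_def by blast
  have heavy: "\<exists>x. 1 / B * sum w H \<le> sum w {S\<in>H. x \<in> S}" if w: "\<And>S. 0 < w S" for w :: "real set \<Rightarrow> real"
  proof (cases "H = {}")
    case False
    then have s: "sum w H > 0" using w assms(3) by (intro sum_pos) auto
    have "\<exists>x. 1 / B \<le> sum (\<lambda>S. w S / sum w H) {S\<in>H. x \<in> S}"
    proof (rule heavy_point[OF assms(3,5) _ p0 ne _ _ L _ B2])
      show "0 \<le> w S / sum w H" for S using w[of S] s by simp
      show "(\<Sum>S\<in>H. w S / sum w H) = 1" using s by (simp flip: sum_divide_distrib)
    qed (use assms(1) in \<open>auto simp: B_def\<close>)
    then show ?thesis using s by (simp add: field_simps flip: sum_divide_distrib)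
  qed simp
  \<comment> \<open>Since \<open>d B < k + 1\<close> strictly, approximate duality already gives the exact bound \<open>k\<close>.\<close>
  define k where "k = nat \<lfloor>real d * B\<rfloor>"
  have k1: "real k \<le> real d * B" unfolding k_def using Bpos by (simp add: of_nat_floor)
  have k2: "real d * B < real k + 1"
    unfolding k_def using Bpos by simp
  have "real d / (real k + 1) < 1 / B"
    using k2 Bpos by (simp add: field_simps)
  from fractional_cover_sample[OF assms(3) _ this heavy]
  obtain xs where xs: "\<And>S. S \<in> H \<Longrightarrow>
      real d / (real k + 1) * real (length xs) < real (length (filter (\<lambda>x. x \<in> S) xs))"
    by auto
  have "d * length xs < (k + 1) * length (filter (\<lambda>x. x \<in> S) xs)" if "S \<in> H" for S
  proof -
    have "real d * real (length xs) < (real k + 1) * real (length (filter (\<lambda>x. x \<in> S) xs))"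
      using xs[OF that] by (simp add: field_simps)
    then have "real (d * length xs) < real ((k + 1) * length (filter (\<lambda>x. x \<in> S) xs))" by (simp add: algebra_simps)
    then show ?thesis by (simp only: of_nat_less_iff)
  qed
  with piercing_number_le_sample[OF assms(4)] have "piercing_number H \<le> k" by blast
  then have "real (piercing_number H) \<le> real d * B" using k1 by linarith
  also have "\<dots> = max (X * real d) (2 * real p ^ 2 * real d)"
    unfolding B_def by (simp add: max_mult_distrib_left mult_ac)
  \<comment> \<open>The factor \<open>d\<close> lost in rounding raises the exponent of
    \<open>d\<close> from \<open>1 / (q - 1)\<close> to \<open>q / (q - 1)\<close>.\<close>
  also have "X * real d = 2 powr (1 / (real q - 1)) * (exp 1 * real p) powr (real q / (real q - 1)) / real q
           * real d powr (real q / (real q - 1))"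
  proof -
    have "real q / (real q - 1) = 1 / (real q - 1) + 1" using qr by (simp add: field_simps)
    then have "real d powr (real q / (real q - 1)) = real d powr (1 / (real q - 1)) * real d"
      by (simp add: powr_add)
    then show ?thesis unfolding X_def by (simp add: powr_mult)
  qed
  finally show ?thesis by linarith
qed

end
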